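(* Assume that the equation $(I-A)x^s-Bu^s=E\mu_W+z$ has a solution $(x^s,u^s)\in\mathbb{R}^n\times\mathbb{R}^l$ and that $(A,Q_1^{1/2})$ is detectable. Let $(X^s_\star(\cdot),U^s_\star(\cdot))$ and $\alpha\in\mathcal{K}_\infty$ be as fixed in the context. Then for every $X_0$ there exists a constant $C\in\mathbb{R}$ such that for each $N\in\mathbb{N}$, each $\delta>0$, each control process $U(\cdot)$ satisfying $J_N(X_0,U(\cdot))\le\delta+\sum_{k=0}^{N-1}\ell(X^s_\star(k),U^s_\star(k))$ and each $\varepsilon,\eta>0$ the value $$\mathcal{S}_{\varepsilon,\eta}:=\#\Big\{k\in\{0,\dots,N-1\}\;\Big|\;\mathbb{P}\big(\|X_U(k,X_0)-X^s_\star(k)\|\ge\varepsilon\big)\le\eta\Big\}$$ satisfies $\mathcal{S}_{\varepsilon,\eta}\ge N-(\delta+C)/\alpha(\varepsilon^2\eta)$.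
   Context: Setting. Let $A\in\mathbb{R}^{n\times n}$, $B\in\mathbb{R}^{n\times l}$ with $(A,B)$ stabilizable, $E\in\mathbb{R}^{n\times m}$, $z\in\mathbb{R}^n$. Let $(\Omega,\mathcal{F},\mathbb{P})$ be a probability space and $\{W(k)\}_{k\in\mathbb{N}_0}\subset L^2(\Omega,\mathcal{F},\mathbb{P};\mathbb{R}^m)$ a fixed i.i.d. sequence with common (not necessarily Gaussian) distribution $\varrho_W$, mean $\mu_W$ and covariance $\Sigma_W$. The stochastic system is $$X(k+1)=f(X(k),U(k),W(k)):=AX(k)+BU(k)+EW(k)+z,\quad X(0)=X_0,$$ where $X(k)\in L^2(\Omega,\mathcal{F}_k,\mathbb{P};\mathbb{R}^n)$, $U(k)\in L^2(\Omega,\mathcal{F}_k,\mathbb{P};\mathbb{R}^l)$, $\mathcal{F}_k=\sigma(X(0),\dots,X(k))$ is the natural filtration of the state process, and $W(k)$ is independent of $X(k)$ and $U(k)$ for every $k$. These standing assumptions apply to every state/control process considered (including stationary ones) and to every $(X(k),U(k))$ in statements quantified over such pairs. $X_U(\cdot,X_0)$ denotes the solution for initial value $X_0$ and control $U(\cdot)$. Stage cost: $$\ell(X,U):=\mathbb{E}\big[X^TQ_1X+U^TR_1U+r^TX+v^TU+c\big]+\mathrm{Tr}\big(Q_2\mathrm{Cov}(X)+R_2\mathrm{Cov}(U)\big),$$ with symmetric $Q_1,Q_2\in\mathbb{R}^{n\times n}$, $R_1,R_2\in\mathbb{R}^{l\times l}$, $Q_1,Q_2,R_2\ge 0$, $R_1>0$,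 $r\in\mathbb{R}^n$, $v\in\mathbb{R}^l$, $c\in\mathbb{R}$. For horizon $N\in\mathbb{N}$, $J_N(X_0,U):=\sum_{k=0}^{N-1}\ell(X(k),U(k))$ along the solution $X(\cdot)=X_U(\cdot,X_0)$. For $M\ge0$, $\|x\|_M:=\sqrt{x^TMx}$; $\|\cdot\|$ is the Euclidean norm. Deterministic vectors are regarded as constant random variables. $\mathcal{K}_\infty$ is the set of continuous, strictly increasing, unbounded $\alpha:[0,\infty)\to[0,\infty)$ with $\alpha(0)=0$. $\mathcal{P}_2(\mathcal{X})$ is the set of probability measures on $\mathcal{X}$ with finite second moment. Data. Under the assumptions of the claim, fix a solution $(x^s,u^s)$ and the following objects (all of which exist). $P$ is the positive semidefinite solution of $P=A^TPA+(Q_1+Q_2)-A^TPB[(R_1+R_2)+B^TPB]^{-1}B^TPA$ and $K:=-[(R_1+R_2)+B^TPB]^{-1}B^TPA$. Put $\hat W(k):=W(k)-\mu_W$, $\hat r:=r+2Q_1x^s$, $\hat v:=v+2R_1u^s$, $\hat c:=(x^s)^TQ_1x^s+(u^s)^TR_1u^s+r^Tx^s+v^Tu^s+c$ and $$\hat\ell(X,U):=\mathbb{E}[X^TQ_1X+U^TR_1U+\hat r^TX+\hat v^TU+\hat c]+\mathrm{Tr}(Q_2\mathrm{Cov}(X)+R_2\mathrm{Cov}(U)).$$ $\hat X^s(\cdot)$ is the process $\hat X^s(k+1)=A\hat X^s(k)+B\hat U^s(k)+E\hat W(k)$, $\hat U^s(k)=K\hat X^s(k)$, with $\hat X^s(k)\sim\hat\varrho_X^s\in\mathcal{P}_2(\mathbb{R}^n)$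 for all $k$ ($\hat\varrho_X^s$ an invariant distribution, with zero mean). Further, $(\tilde x^s_\star,\tilde u^s_\star)$ is a solution of $(I-A)x-Bu=0$, $\alpha\in\mathcal{K}_\infty$, $S\in\mathbb{R}^{n\times n}$ is symmetric positive definite and $q\in\mathbb{R}^n$, such that, with $\tilde X(k):=X(k)-x^s-\hat X^s(k)$, $\tilde U(k):=U(k)-u^s-\hat U^s(k)$, $\tilde X(k+1):=A\tilde X(k)+B\tilde U(k)$ and $\tilde\lambda(Y):=\mathbb{E}[\|Y\|_S^2+q^TY]$, the inequality $$\hat\ell(\tilde X(k),\tilde U(k))-\hat\ell(\tilde x^s_\star,\tilde u^s_\star)+\tilde\lambda(\tilde X(k))-\tilde\lambda(\tilde X(k+1))\ge\alpha\big(\mathbb{E}[\|\tilde X(k)-\tilde x^s_\star\|^2]\big)$$ holds for all $k\in\mathbb{N}_0$ and all $(X(k),U(k))\in L^2(\Omega,\mathcal{F}_k,\mathbb{P};\mathbb{R}^n)\times L^2(\Omega,\mathcal{F}_k,\mathbb{P};\mathbb{R}^l)$. The stationary pair $(X^s_\star(\cdot),U^s_\star(\cdot))$ is defined by $X^s_\star(0)=\hat X^s(0)+x^s+\tilde x^s_\star$, $X^s_\star(k+1)=f(X^s_\star(k),U^s_\star(k),W(k))$, $U^s_\star(k)=K(X^s_\star(k)-\tilde x^s_\star-x^s)+\tilde u^s_\star+u^s$; the law of $X^s_\star(k)$ is independent of $k$ and denoted $\varrho_X^{s,\star}\in\mathcal{P}_2(\mathbb{R}^n)$. *)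

theory Defs
  imports "HOL-Probability.Probability"
begin

section \<open>Matrices and comparison functions\<close>

definition psd :: "real^'n^'n \<Rightarrow> bool" where
  "psd Q \<longleftrightarrow> transpose Q = Q \<and> (\<forall>x. 0 \<le> x \<bullet> (Q *v x))"

definition pos_def :: "real^'n^'n \<Rightarrow> bool" where
  "pos_def Q \<longleftrightarrow> transpose Q = Q \<and> (\<forall>x. x \<noteq> 0 \<longrightarrow> 0 < x \<bullet> (Q *v x))"

text \<open>For positive semidefinite \<open>Q\<close> the matrix described here exists and is unique.\<close>

definition psd_sqrt :: "real^'n^'n \<Rightarrow> real^'n^'n" where
  "psd_sqrt Q = (THE R. psd R \<and> R ** R = Q)"

text \<open>All eigenvalues, including the non-real ones, lie in the open unit disc.\<close>

definition schur_stable :: "real^'n^'n \<Rightarrow> bool" where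
  "schur_stable A \<longleftrightarrow>
     (\<forall>lam v. v \<noteq> 0 \<and> map_matrix complex_of_real A *v v = lam *s v \<longrightarrow> cmod lam < 1)"

definition stabilizable :: "real^'n^'n \<Rightarrow> real^'l^'n \<Rightarrow> bool" where
  "stabilizable A B \<longleftrightarrow> (\<exists>F :: real^'n^'l. schur_stable (A + B ** F))"

definition detectable :: "real^'n^'n \<Rightarrow> real^'n^'p \<Rightarrow> bool" where
  "detectable A C \<longleftrightarrow> (\<exists>L :: real^'p^'n. schur_stable (A + L ** C))"

definition mat_norm :: "real^'n^'n \<Rightarrow> real^'n \<Rightarrow> real" where
  "mat_norm Q x = sqrt (x \<bullet> (Q *v x))"

text \<open>Functions on \<open>[0,\<infinity>)\<close> are represented by functions on the reals whose values at negative
  arguments are irrelevant.\<close>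

definition class_K_inf :: "(real \<Rightarrow> real) set" where
  "class_K_inf = {\<alpha>. continuous_on {0..} \<alpha> \<and> strict_mono_on {0..} \<alpha> \<and> \<alpha> 0 = 0 \<and>
                     \<not> bdd_above (\<alpha> ` {0..})}"

section \<open>Random variables\<close>

text \<open>Square-integrable random variables measurable with respect to the sub-\<open>\<sigma>\<close>-algebra \<open>F\<close>
  (elements are functions, not equivalence classes).\<close>

definition L2 :: "'w measure \<Rightarrow> 'w measure \<Rightarrow> ('w \<Rightarrow> 'a::euclidean_space) set" where
  "L2 M F = {X. subalgebra M F \<and> X \<in> borel_measurable F \<and> integrable M (\<lambda>\<omega>. (norm (X \<omega>))\<^sup>2)}"

definition P2 :: "('a::euclidean_space) measure set" where
  "P2 = {\<rho>. prob_space \<rho> \<and> sets \<rho> = sets borel \<and> integrable \<rho> (\<lambda>x. (norm x)\<^sup>2)}"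

definition natural_filtration ::
    "'w measure \<Rightarrow> (nat \<Rightarrow> 'w \<Rightarrow> 'a::euclidean_space) \<Rightarrow> nat \<Rightarrow> 'w measure" where
  "natural_filtration M X k =
     sigma (space M) (\<Union>i\<le>k. {X i -` T \<inter> space M |T. T \<in> sets borel})"

text \<open>The library's \<open>indep_var\<close> requires both random variables to have the same value type,
  hence independence is expressed through the generated \<open>\<sigma>\<close>-algebras.\<close>

definition indep_rv ::
    "'w measure \<Rightarrow> ('w \<Rightarrow> 'a::euclidean_space) \<Rightarrow> ('w \<Rightarrow> 'b::euclidean_space) \<Rightarrow> bool" where
  "indep_rv M X Y \<longleftrightarrow> prob_space.indep_set M
     {X -` T \<inter> space M |T. T \<in> sets borel} {Y -` T \<inter> space M |T. T \<in> sets borel}"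

definition Cov :: "'w measure \<Rightarrow> ('w \<Rightarrow> real^'n) \<Rightarrow> real^'n^'n" where
  "Cov M X = (\<chi> i j. \<integral>\<omega>. (X \<omega> $ i - (\<integral>\<omega>'. X \<omega>' $ i \<partial>M)) * (X \<omega> $ j - (\<integral>\<omega>'. X \<omega>' $ j \<partial>M)) \<partial>M)"

section \<open>The stochastic control system\<close>

definition sys :: "real^'n^'n \<Rightarrow> real^'l^'n \<Rightarrow> real^'m^'n \<Rightarrow> real^'n \<Rightarrow>
    real^'n \<Rightarrow> real^'l \<Rightarrow> real^'m \<Rightarrow> real^'n" where
  "sys A B E z x u w = A *v x + B *v u + E *v w + z"

primrec solution :: "real^'n^'n \<Rightarrow> real^'l^'n \<Rightarrow> real^'m^'n \<Rightarrow> real^'n \<Rightarrow> (nat \<Rightarrow> 'w \<Rightarrow> real^'m) \<Rightarrow>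
    (nat \<Rightarrow> 'w \<Rightarrow> real^'l) \<Rightarrow> ('w \<Rightarrow> real^'n) \<Rightarrow> nat \<Rightarrow> 'w \<Rightarrow> real^'n" where
  "solution A B E z W U X0 0 = X0"
| "solution A B E z W U X0 (Suc k) =
     (\<lambda>\<omega>. sys A B E z (solution A B E z W U X0 k \<omega>) (U k \<omega>) (W k \<omega>))"

primrec feedback_solution :: "real^'n^'n \<Rightarrow> real^'l^'n \<Rightarrow> real^'m^'n \<Rightarrow> real^'n \<Rightarrow>
    (nat \<Rightarrow> 'w \<Rightarrow> real^'m) \<Rightarrow> (real^'n \<Rightarrow> real^'l) \<Rightarrow> ('w \<Rightarrow> real^'n) \<Rightarrow> nat \<Rightarrow> 'w \<Rightarrow> real^'n" where
  "feedback_solution A B E z W \<kappa> X0 0 = X0"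
| "feedback_solution A B E z W \<kappa> X0 (Suc k) =
     (\<lambda>\<omega>. sys A B E z (feedback_solution A B E z W \<kappa> X0 k \<omega>)
                      (\<kappa> (feedback_solution A B E z W \<kappa> X0 k \<omega>)) (W k \<omega>))"

text \<open>The standing assumptions on a state process \<open>X\<close> and its control process \<open>U\<close>; the filtration
  is the one generated by \<open>X\<close> itself.\<close>

definition admissible :: "'w measure \<Rightarrow> (nat \<Rightarrow> 'w \<Rightarrow> real^'m) \<Rightarrow>
    (nat \<Rightarrow> 'w \<Rightarrow> real^'n) \<Rightarrow> (nat \<Rightarrow> 'w \<Rightarrow> real^'l) \<Rightarrow> bool" where
  "admissible M W X U \<longleftrightarrow> (\<forall>k.
     X k \<in> L2 M (natural_filtration M X k) \<and> U k \<in> L2 M (natural_filtration M X k) \<and>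
     indep_rv M (W k) (X k) \<and> indep_rv M (W k) (U k))"

text \<open>The two covariance terms are traced separately because they have different sizes.\<close>

definition stage_cost :: "'w measure \<Rightarrow> real^'n^'n \<Rightarrow> real^'n^'n \<Rightarrow> real^'l^'l \<Rightarrow> real^'l^'l \<Rightarrow>
    real^'n \<Rightarrow> real^'l \<Rightarrow> real \<Rightarrow> ('w \<Rightarrow> real^'n) \<Rightarrow> ('w \<Rightarrow> real^'l) \<Rightarrow> real" where
  "stage_cost M Q1 Q2 R1 R2 r v c X U =
     (\<integral>\<omega>. X \<omega> \<bullet> (Q1 *v X \<omega>) + U \<omega> \<bullet> (R1 *v U \<omega>) + r \<bullet> X \<omega> + v \<bullet> U \<omega> + c \<partial>M)
     + (trace (Q2 ** Cov M X) + trace (R2 ** Cov M U))"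

definition storage :: "'w measure \<Rightarrow> real^'n^'n \<Rightarrow> real^'n \<Rightarrow> ('w \<Rightarrow> real^'n) \<Rightarrow> real" where
  "storage M S q Y = (\<integral>\<omega>. (mat_norm S (Y \<omega>))\<^sup>2 + q \<bullet> Y \<omega> \<partial>M)"

end

theory Submission
  imports Defs
begin

text \<open>The turnpike property is a consequence of strict dissipativity, but the dissipation inequality
  speaks of the deviation \<open>Xt = X - xs - Xhat\<close> and of the shifted cost, whereas the performance bound
  speaks of the original cost along \<open>X\<close> and \<open>Xstar\<close>. The proof compares the two.

  Shifting by the steady state \<open>(xs, us)\<close> is absorbed by the change from \<open>r, v, c\<close> to \<open>rhat, vhat, chat\<close> (\<open>stage_cost_shift\<close>). Removing then the centred process
  \<open>Xhat\<close> from the quadratic cost leaves the shifted cost of \<open>Xt\<close>, a term that depends on \<open>Xhat\<close> only,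
  and a mixed term (\<open>stage_cost_add_centred\<close>). For the stationary pair the deviation is the constant
  \<open>(xt, ut)\<close>: the same term in \<open>Xhat\<close> appears, and it cancels in the difference, while the mixed term
  vanishes because \<open>Xhat\<close> has mean zero.

  Because \<open>Uhat = K Xhat\<close> with the Riccati gain \<open>K\<close>, the mixed term at time \<open>k\<close> is twice the expectation of \<open>Xt k \<bullet> P Xhat k - Xt (k+1) \<bullet> P (A + B K) Xhat k\<close>
  (\<open>riccati_cross_term\<close>). In the second product \<open>(A + B K) Xhat k\<close> may be replaced by \<open>Xhat (k+1)\<close>: they
  differ by the centred noise at time \<open>k\<close>, which is uncorrelated with \<open>Xt (k+1)\<close>, an affine function
  of random vectors each of which is independent of that noise (\<open>indep_rv_uncorrelated\<close>). So the mixed terms telescope: however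
  large they are, after summation only the first and the last value of \<open>2 E[Xt k \<bullet> P Xhat k]\<close> remain.

  The last value is not bounded uniformly in the control, but the quadratic part of the storage at the
  final time dominates it; completing the square leaves a quantity that depends on
  the law of \<open>Xhat N\<close> only, and this law does not depend on \<open>N\<close>
  (\<open>storage_minus_cross_term_bounded_below\<close>). Hence the sum of \<open>\<alpha>\<close> at the mean square deviations is at
  most \<open>\<delta> + C\<close>. By Chebyshev's inequality every exceptional time contributes at least
  \<open>\<alpha> (\<epsilon>\<^sup>2 * \<eta>)\<close> to it, which bounds their number (\<open>sum_K_inf_counts_small_deviations\<close>).\<close>

section \<open>Square-integrable random vectors\<close>

lemma L2_full:
  assumes "X \<in> L2 M F"
  shows "X \<in> L2 M M"
  using assms unfolding L2_def by (auto intro: measurable_from_subalg simp: subalgebra_def)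

lemma L2_measurable: "X \<in> L2 M M \<Longrightarrow> X \<in> borel_measurable M"
  by (simp add: L2_def)

lemma L2_norm_integrable: "X \<in> L2 M M \<Longrightarrow> integrable M (\<lambda>\<omega>. (norm (X \<omega>))\<^sup>2)"
  by (simp add: L2_def)

lemma L2_const:
  assumes "prob_space M"
  shows "(\<lambda>_. a) \<in> L2 M M"
proof -
  interpret prob_space M by fact
  show ?thesis by (simp add: L2_def subalgebra_def)
qed

lemma L2_add:
  fixes X Y :: "'w \<Rightarrow> 'a::euclidean_space"
  assumes X: "X \<in> L2 M M" and Y: "Y \<in> L2 M M"
  shows "(\<lambda>\<omega>. X \<omega> + Y \<omega>) \<in> L2 M M"
proof -
  note [measurable] = L2_measurable[OF X] L2_measurable[OF Y]
  have bound: "(norm (x + y))\<^sup>2 \<le> 2 * (norm x)\<^sup>2 + 2 * (norm y)\<^sup>2" for x y :: 'a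
  proof -
    have "(norm (x + y))\<^sup>2 \<le> (norm x + norm y)\<^sup>2"
      by (intro power_mono norm_triangle_ineq) simp
    also have "\<dots> \<le> 2 * (norm x)\<^sup>2 + 2 * (norm y)\<^sup>2"
      using sum_squares_bound[of "norm x" "norm y"] by (simp add: power2_sum)
    finally show ?thesis .
  qed
  have "integrable M (\<lambda>\<omega>. 2 * (norm (X \<omega>))\<^sup>2 + 2 * (norm (Y \<omega>))\<^sup>2)"
    using L2_norm_integrable[OF X] L2_norm_integrable[OF Y] by simp
  then have "integrable M (\<lambda>\<omega>. (norm (X \<omega> + Y \<omega>))\<^sup>2)"
    by (rule Bochner_Integration.integrable_bound)
      (auto intro!: AE_I2 order_trans[OF bound])
  then show ?thesis
    by (simp add: L2_def subalgebra_def)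
qed

lemma L2_bounded_linear:
  assumes T: "bounded_linear T" and X: "X \<in> L2 M M"
  shows "(\<lambda>\<omega>. T (X \<omega>)) \<in> L2 M M"
proof -
  note [measurable] = L2_measurable[OF X] borel_measurable_continuous_onI[OF linear_continuous_on[OF T]]
  obtain b where b: "\<And>x. norm (T x) \<le> norm x * b"
    using bounded_linear.bounded[OF T] by blast
  have bound: "(norm (T x))\<^sup>2 \<le> b\<^sup>2 * (norm x)\<^sup>2" for x
    using power_mono[OF b[of x], of 2] by (simp add: power_mult_distrib mult.commute)
  have "integrable M (\<lambda>\<omega>. b\<^sup>2 * (norm (X \<omega>))\<^sup>2)"
    using L2_norm_integrable[OF X] by simp
  then have "integrable M (\<lambda>\<omega>. (norm (T (X \<omega>)))\<^sup>2)"
    by (rule Bochner_Integration.integrable_bound) (auto intro!: AE_I2 bound)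
  moreover have "(\<lambda>\<omega>. T (X \<omega>)) \<in> borel_measurable M"
    by measurable
  ultimately show ?thesis
    by (simp add: L2_def subalgebra_def)
qed

lemma L2_matrix:
  fixes T :: "real^'a^'b"
  shows "X \<in> L2 M M \<Longrightarrow> (\<lambda>\<omega>. T *v X \<omega>) \<in> L2 M M"
  by (rule L2_bounded_linear[OF matrix_vector_mul_bounded_linear])

lemma L2_diff:
  assumes "X \<in> L2 M M" "Y \<in> L2 M M"
  shows "(\<lambda>\<omega>. X \<omega> - Y \<omega>) \<in> L2 M M"
  using L2_add[OF assms(1) L2_bounded_linear[OF bounded_linear_minus[OF bounded_linear_ident] assms(2)]]
  by simp

lemma L2_inner_integrable:
  fixes X Y :: "'w \<Rightarrow> 'a::euclidean_space"
  assumes X: "X \<in> L2 M M" and Y: "Y \<in> L2 M M"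
  shows "integrable M (\<lambda>\<omega>. X \<omega> \<bullet> Y \<omega>)"
proof -
  note [measurable] = L2_measurable[OF X] L2_measurable[OF Y]
  have bound: "\<bar>x \<bullet> y\<bar> \<le> (norm x)\<^sup>2 + (norm y)\<^sup>2" for x y :: 'a
  proof -
    have "\<bar>x \<bullet> y\<bar> \<le> norm x * norm y"
      by (rule Cauchy_Schwarz_ineq2)
    also have "\<dots> \<le> (norm x)\<^sup>2 + (norm y)\<^sup>2"
      using sum_squares_bound[of "norm x" "norm y"] mult_nonneg_nonneg[of "norm x" "norm y"]
      by (simp del: mult_nonneg_nonneg)
    finally show ?thesis .
  qed
  have "integrable M (\<lambda>\<omega>. (norm (X \<omega>))\<^sup>2 + (norm (Y \<omega>))\<^sup>2)"
    using L2_norm_integrable[OF X] L2_norm_integrable[OF Y] by simp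
  then show ?thesis
    by (rule Bochner_Integration.integrable_bound) (auto intro!: AE_I2 order_trans[OF bound])
qed

lemma L2_integrable:
  assumes "prob_space M" and X: "X \<in> L2 M M"
  shows "integrable M X"
proof -
  interpret prob_space M by fact
  have bound: "norm x \<le> 1 + (norm x)\<^sup>2" for x :: 'b
    using sum_squares_bound[of 1 "norm x"] norm_ge_zero[of x] unfolding power_one by linarith
  have "integrable M (\<lambda>\<omega>. 1 + (norm (X \<omega>))\<^sup>2)"
    using L2_norm_integrable[OF X] by simp
  then show ?thesis
    by (rule Bochner_Integration.integrable_bound)
      (use L2_measurable[OF X] in \<open>auto intro!: AE_I2 simp: bound\<close>)
qed

lemma matrix_inner_adjoint:
  fixes T :: "real^'n^'m"
  shows "(T *v x) \<bullet> y = x \<bullet> (transpose T *v y)"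
  by (metis dot_lmul_matrix inner_commute transpose_matrix_vector)

lemma symmetric_matrix_inner:
  fixes T :: "real^'n^'n"
  assumes "transpose T = T"
  shows "x \<bullet> (T *v y) = y \<bullet> (T *v x)"
  by (metis assms matrix_inner_adjoint inner_commute)

lemma expectation_quadratic_add:
  fixes Q :: "real^'n^'n"
  assumes "X \<in> L2 M M" "Y \<in> L2 M M" and sym: "transpose Q = Q"
  shows "(\<integral>\<omega>. (X \<omega> + Y \<omega>) \<bullet> (Q *v (X \<omega> + Y \<omega>)) \<partial>M) =
    (\<integral>\<omega>. X \<omega> \<bullet> (Q *v X \<omega>) \<partial>M) + 2 * (\<integral>\<omega>. X \<omega> \<bullet> (Q *v Y \<omega>) \<partial>M) + (\<integral>\<omega>. Y \<omega> \<bullet> (Q *v Y \<omega>) \<partial>M)"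
proof -
  have "(x + y) \<bullet> (Q *v (x + y)) = x \<bullet> (Q *v x) + 2 * (x \<bullet> (Q *v y)) + y \<bullet> (Q *v y)" for x y
  proof -
    show ?thesis
      using symmetric_matrix_inner[OF sym, of y x]
      by (simp add: matrix_vector_right_distrib inner_add_left inner_add_right)
  qed
  then show ?thesis
    using assms by (simp add: L2_inner_integrable L2_matrix)
qed

text \<open>The covariance part of the cost thus is the quadratic form of the second moments corrected by
  that of the mean, so that all terms of the cost can be expanded by bilinearity.\<close>

lemma trace_Cov:
  fixes X :: "'w \<Rightarrow> real^'n"
  assumes prob: "prob_space M" and X: "X \<in> L2 M M"
  shows "trace (Q ** Cov M X) =
    (\<integral>\<omega>. X \<omega> \<bullet> (Q *v X \<omega>) \<partial>M) - (\<integral>\<omega>. X \<omega> \<partial>M) \<bullet> (Q *v (\<integral>\<omega>. X \<omega> \<partial>M))"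
proof -
  interpret prob_space M by (rule prob)
  define m where "m = (\<integral>\<omega>. X \<omega> \<partial>M)"
  define Y where "Y = (\<lambda>\<omega>. X \<omega> - m)"
  note int = L2_integrable[OF prob X]
  have m: "(\<integral>\<omega>. X \<omega> $ i \<partial>M) = m $ i" for i
    unfolding m_def by (rule integral_bounded_linear[OF bounded_linear_vec_nth int])
  have Y: "Y \<in> L2 M M"
    unfolding Y_def by (intro L2_diff X L2_const prob)
  have comp: "(\<lambda>\<omega>. Y \<omega> $ i) \<in> L2 M M" for i
    by (rule L2_bounded_linear[OF bounded_linear_vec_nth Y])
  have prod: "integrable M (\<lambda>\<omega>. Y \<omega> $ j * Y \<omega> $ i)" for i j
    using L2_inner_integrable[OF comp comp, of j i] by simp
  have "trace (Q ** Cov M X) = (\<Sum>i\<in>UNIV. \<Sum>j\<in>UNIV. Q $ i $ j * (\<integral>\<omega>. Y \<omega> $ j * Y \<omega> $ i \<partial>M))"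
    by (simp add: trace_def matrix_matrix_mult_def Cov_def Y_def m)
  also have "\<dots> = (\<integral>\<omega>. (\<Sum>i\<in>UNIV. \<Sum>j\<in>UNIV. Q $ i $ j * (Y \<omega> $ j * Y \<omega> $ i)) \<partial>M)"
    by (simp add: prod)
  also have "\<dots> = (\<integral>\<omega>. Y \<omega> \<bullet> (Q *v Y \<omega>) \<partial>M)"
    by (simp add: inner_vec_def matrix_vector_mult_def sum_distrib_left mult_ac)
  also have "\<dots> = (\<integral>\<omega>. X \<omega> \<bullet> (Q *v X \<omega>) - X \<omega> \<bullet> (Q *v m) - (transpose Q *v m) \<bullet> X \<omega> + m \<bullet> (Q *v m) \<partial>M)"
    by (simp add: Y_def matrix_vector_mult_diff_distrib inner_diff_left inner_diff_right
        transpose_matrix_vector dot_lmul_matrix algebra_simps)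
  also have "\<dots> = (\<integral>\<omega>. X \<omega> \<bullet> (Q *v X \<omega>) \<partial>M) - m \<bullet> (Q *v m) - (transpose Q *v m) \<bullet> m + m \<bullet> (Q *v m)"
    using L2_inner_integrable[OF X L2_matrix[OF X]] int
    by (simp add: m_def[symmetric] prob_space)
  finally show ?thesis
    by (simp add: m_def transpose_matrix_vector dot_lmul_matrix)
qed

section \<open>Algebra of the stage cost\<close>

lemma stage_cost_eq:
  assumes prob: "prob_space M" and X: "X \<in> L2 M M" and U: "U \<in> L2 M M"
  shows "stage_cost M Q1 Q2 R1 R2 r v c X U =
    (\<integral>\<omega>. X \<omega> \<bullet> (Q1 *v X \<omega>) \<partial>M) + (\<integral>\<omega>. U \<omega> \<bullet> (R1 *v U \<omega>) \<partial>M)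
    + r \<bullet> (\<integral>\<omega>. X \<omega> \<partial>M) + v \<bullet> (\<integral>\<omega>. U \<omega> \<partial>M) + c
    + (\<integral>\<omega>. X \<omega> \<bullet> (Q2 *v X \<omega>) \<partial>M) - (\<integral>\<omega>. X \<omega> \<partial>M) \<bullet> (Q2 *v (\<integral>\<omega>. X \<omega> \<partial>M))
    + (\<integral>\<omega>. U \<omega> \<bullet> (R2 *v U \<omega>) \<partial>M) - (\<integral>\<omega>. U \<omega> \<partial>M) \<bullet> (R2 *v (\<integral>\<omega>. U \<omega> \<partial>M))"
proof -
  interpret prob_space M by (rule prob)
  show ?thesis
    unfolding stage_cost_def trace_Cov[OF prob X] trace_Cov[OF prob U]
    using X U L2_integrable[OF prob X] L2_integrable[OF prob U]
    by (simp add: L2_inner_integrable L2_matrix prob_space)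
qed

text \<open>All terms that are not affine are quadratic, so adding a pair costs the two separate costs
  plus twice the polarization; the constant \<open>c\<close> would otherwise be counted twice.\<close>

lemma stage_cost_add:
  assumes prob: "prob_space M"
    and L2: "X \<in> L2 M M" "U \<in> L2 M M" "Y \<in> L2 M M" "V \<in> L2 M M"
    and sym: "transpose Q1 = Q1" "transpose Q2 = Q2" "transpose R1 = R1" "transpose R2 = R2"
  shows "stage_cost M Q1 Q2 R1 R2 r v c (\<lambda>\<omega>. X \<omega> + Y \<omega>) (\<lambda>\<omega>. U \<omega> + V \<omega>) =
    stage_cost M Q1 Q2 R1 R2 r v c X U + stage_cost M Q1 Q2 R1 R2 r v c Y V - c
    + 2 * ((\<integral>\<omega>. X \<omega> \<bullet> (Q1 *v Y \<omega>) \<partial>M) + (\<integral>\<omega>. U \<omega> \<bullet> (R1 *v V \<omega>) \<partial>M)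
         + ((\<integral>\<omega>. X \<omega> \<bullet> (Q2 *v Y \<omega>) \<partial>M) - (\<integral>\<omega>. X \<omega> \<partial>M) \<bullet> (Q2 *v (\<integral>\<omega>. Y \<omega> \<partial>M)))
         + ((\<integral>\<omega>. U \<omega> \<bullet> (R2 *v V \<omega>) \<partial>M) - (\<integral>\<omega>. U \<omega> \<partial>M) \<bullet> (R2 *v (\<integral>\<omega>. V \<omega> \<partial>M))))"
proof -
  have swap: "y \<bullet> (T *v x) = x \<bullet> (T *v y)" if "transpose T = T" for T :: "real^'k^'k" and x y
    by (metis that dot_lmul_matrix inner_commute transpose_matrix_vector)
  note int = L2[THEN L2_integrable[OF prob]]
  have comm: "(\<integral>\<omega>. Y \<omega> \<partial>M) \<bullet> (Q2 *v (\<integral>\<omega>. X \<omega> \<partial>M)) = (\<integral>\<omega>. X \<omega> \<partial>M) \<bullet> (Q2 *v (\<integral>\<omega>. Y \<omega> \<partial>M))"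
    "(\<integral>\<omega>. V \<omega> \<partial>M) \<bullet> (R2 *v (\<integral>\<omega>. U \<omega> \<partial>M)) = (\<integral>\<omega>. U \<omega> \<partial>M) \<bullet> (R2 *v (\<integral>\<omega>. V \<omega> \<partial>M))"
    by (intro symmetric_matrix_inner sym)+
  have sum: "(\<integral>\<omega>. X \<omega> + Y \<omega> \<partial>M) = (\<integral>\<omega>. X \<omega> \<partial>M) + (\<integral>\<omega>. Y \<omega> \<partial>M)"
    "(\<integral>\<omega>. U \<omega> + V \<omega> \<partial>M) = (\<integral>\<omega>. U \<omega> \<partial>M) + (\<integral>\<omega>. V \<omega> \<partial>M)"
    by (simp_all add: int)
  show ?thesis
    unfolding stage_cost_eq[OF prob L2(1,2)] stage_cost_eq[OF prob L2(3,4)]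
      stage_cost_eq[OF prob L2_add[OF L2(1,3)] L2_add[OF L2(2,4)]]
      expectation_quadratic_add[OF L2(1,3) sym(1)] expectation_quadratic_add[OF L2(1,3) sym(2)]
      expectation_quadratic_add[OF L2(2,4) sym(3)] expectation_quadratic_add[OF L2(2,4) sym(4)]
    unfolding sum inner_add_left inner_add_right matrix_vector_right_distrib comm
    by argo
qed

text \<open>The mixed terms with a deterministic vector are linear in the mean, hence can be moved into the
  linear coefficients; covariances do not see the shift.\<close>

lemma stage_cost_shift:
  assumes prob: "prob_space M"
    and L2: "X \<in> L2 M M" "U \<in> L2 M M"
    and sym: "transpose Q1 = Q1" "transpose Q2 = Q2" "transpose R1 = R1" "transpose R2 = R2"
  shows "stage_cost M Q1 Q2 R1 R2 r v c (\<lambda>\<omega>. X \<omega> + x) (\<lambda>\<omega>. U \<omega> + u) =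
    stage_cost M Q1 Q2 R1 R2 (r + 2 *\<^sub>R (Q1 *v x)) (v + 2 *\<^sub>R (R1 *v u))
      (x \<bullet> (Q1 *v x) + u \<bullet> (R1 *v u) + r \<bullet> x + v \<bullet> u + c) X U"
proof -
  interpret prob_space M by (rule prob)
  note int = L2[THEN L2_integrable[OF prob]]
  have lin: "(\<integral>\<omega>. X \<omega> \<bullet> a \<partial>M) = a \<bullet> (\<integral>\<omega>. X \<omega> \<partial>M)" "(\<integral>\<omega>. U \<omega> \<bullet> b \<partial>M) = b \<bullet> (\<integral>\<omega>. U \<omega> \<partial>M)"
    for a b
    using int by (simp_all add: inner_commute)
  have const: "(\<integral>\<omega>. a \<partial>M) = a" for a :: "'z::euclidean_space"
    by (simp add: prob_space)
  have comm: "(\<integral>\<omega>. X \<omega> \<partial>M) \<bullet> (Q2 *v x) = (Q2 *v x) \<bullet> (\<integral>\<omega>. X \<omega> \<partial>M)"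
    "(\<integral>\<omega>. U \<omega> \<partial>M) \<bullet> (R2 *v u) = (R2 *v u) \<bullet> (\<integral>\<omega>. U \<omega> \<partial>M)"
    by (rule inner_commute)+
  show ?thesis
    unfolding stage_cost_add[OF prob L2 L2_const[OF prob] L2_const[OF prob] sym]
      stage_cost_eq[OF prob L2] stage_cost_eq[OF prob L2_const[OF prob] L2_const[OF prob]]
    unfolding lin const inner_add_left inner_scaleR_left comm
    by argo
qed

text \<open>For a centred summand the means drop out of the covariance mixed terms, so that expectation and
  covariance weights enter only through the sums \<open>Q1 + Q2\<close> and \<open>R1 + R2\<close>, which are the weights of the
  Riccati equation.\<close>

lemma stage_cost_add_centred:
  assumes prob: "prob_space M"
    and L2: "X \<in> L2 M M" "U \<in> L2 M M" "Y \<in> L2 M M"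
    and sym: "transpose Q1 = Q1" "transpose Q2 = Q2" "transpose R1 = R1" "transpose R2 = R2"
    and mean: "(\<integral>\<omega>. Y \<omega> \<partial>M) = 0"
  shows "stage_cost M Q1 Q2 R1 R2 r v c (\<lambda>\<omega>. X \<omega> + Y \<omega>) (\<lambda>\<omega>. U \<omega> + K *v Y \<omega>) =
    stage_cost M Q1 Q2 R1 R2 r v c X U + stage_cost M Q1 Q2 R1 R2 r v c Y (\<lambda>\<omega>. K *v Y \<omega>) - c
    + 2 * (\<integral>\<omega>. X \<omega> \<bullet> ((Q1 + Q2) *v Y \<omega>) + U \<omega> \<bullet> ((R1 + R2) *v (K *v Y \<omega>)) \<partial>M)"
proof -
  have "(\<integral>\<omega>. K *v Y \<omega> \<partial>M) = 0"
    using integral_bounded_linear[OF matrix_vector_mul_bounded_linear L2_integrable[OF prob L2(3)], of K] mean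
    by simp
  then show ?thesis
    using assms
    by (simp add: stage_cost_add L2_matrix L2_inner_integrable matrix_vector_mult_add_rdistrib
        inner_add_right)
qed

section \<open>Independence\<close>

text \<open>Two random vectors of different dimension cannot be compared by \<open>indep_var\<close>, but scalar functions
  of them can. Such functions generate smaller \<open>\<sigma>\<close>-algebras, so independence is inherited.\<close>

lemma indep_rv_indep_var:
  fixes X :: "'w \<Rightarrow> 'a::euclidean_space" and Y :: "'w \<Rightarrow> 'b::euclidean_space"
  assumes prob: "prob_space M" and ind: "indep_rv M X Y"
    and [measurable]: "X \<in> borel_measurable M" "Y \<in> borel_measurable M"
      "f \<in> borel_measurable borel" "g \<in> borel_measurable borel"
  shows "prob_space.indep_var M borel (\<lambda>\<omega>. f (X \<omega>) :: real) borel (\<lambda>\<omega>. g (Y \<omega>) :: real)"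
proof -
  interpret prob_space M by (rule prob)
  let ?G = "\<lambda>h. {h -` T \<inter> space M | T. T \<in> sets borel}"
  have sub: "?G (\<lambda>\<omega>. h (Z \<omega>)) \<subseteq> ?G Z"
    if h: "h \<in> borel_measurable borel" for h :: "'k::euclidean_space \<Rightarrow> real" and Z :: "'w \<Rightarrow> 'k"
  proof safe
    fix T :: "real set" assume "T \<in> sets borel"
    then have "h -` T \<in> sets borel"
      using measurable_sets[OF h] by fastforce
    then show "\<exists>T'. (\<lambda>\<omega>. h (Z \<omega>)) -` T \<inter> space M = Z -` T' \<inter> space M \<and> T' \<in> sets borel"
      by (intro exI[of _ "h -` T"]) auto
  qed
  have "indep_set (?G X) (?G Y)"
    using ind by (simp add: indep_rv_def)
  then have "indep_set (?G (\<lambda>\<omega>. f (X \<omega>))) (?G (\<lambda>\<omega>. g (Y \<omega>)))"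
    using sub[of f X] sub[of g Y] unfolding indep_set_def
    by (elim indep_sets_mono_sets) (auto split: bool.split)
  moreover have "Int_stable (?G h)" for h :: "'w \<Rightarrow> real"
  proof (rule Int_stableI, safe)
    fix S T :: "real set" assume "S \<in> sets borel" "T \<in> sets borel"
    then show "\<exists>R. h -` S \<inter> space M \<inter> (h -` T \<inter> space M) = h -` R \<inter> space M \<and> R \<in> sets borel"
      by (intro exI[of _ "S \<inter> T"]) auto
  qed
  ultimately show ?thesis
    by (auto simp: indep_var_eq intro!: indep_set_sigma_sets)
qed

text \<open>Independence gives orthogonality coordinate by coordinate, where the product rule for
  real-valued random variables applies.\<close>

lemma indep_rv_uncorrelated:
  fixes W :: "'w \<Rightarrow> real^'m" and X :: "'w \<Rightarrow> real^'n" and T :: "real^'m^'n"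
  assumes prob: "prob_space M" and ind: "indep_rv M W X"
    and W: "W \<in> L2 M M" and X: "X \<in> L2 M M"
  shows "(\<integral>\<omega>. X \<omega> \<bullet> (T *v (W \<omega> - (\<integral>\<omega>. W \<omega> \<partial>M))) \<partial>M) = 0"
proof -
  interpret prob_space M by (rule prob)
  define m where "m = (\<integral>\<omega>. W \<omega> \<partial>M)"
  define V where "V = (\<lambda>\<omega>. T *v (W \<omega> - m))"
  have V: "V \<in> L2 M M"
    unfolding V_def by (intro L2_matrix L2_diff L2_const W prob)
  note intV = L2_integrable[OF prob V] and intX = L2_integrable[OF prob X]
  have "(\<integral>\<omega>. V \<omega> \<partial>M) = T *v (\<integral>\<omega>. W \<omega> - m \<partial>M)"
    unfolding V_def
    by (intro integral_bounded_linear matrix_vector_mul_bounded_linear L2_integrable[OF prob]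
        L2_diff L2_const W prob)
  also have "(\<integral>\<omega>. W \<omega> - m \<partial>M) = 0"
    using L2_integrable[OF prob W] by (simp add: m_def prob_space)
  finally have mean: "(\<integral>\<omega>. V \<omega> \<partial>M) = 0" by simp
  have "(\<integral>\<omega>. V \<omega> \<bullet> b * (X \<omega> \<bullet> b) \<partial>M) = 0 \<and> integrable M (\<lambda>\<omega>. V \<omega> \<bullet> b * (X \<omega> \<bullet> b))" for b
  proof -
    have [measurable]: "(\<lambda>w. T *v (w - m)) \<in> borel_measurable borel"
      by (intro borel_measurable_continuous_onI continuous_intros
          linear_continuous_on_compose[OF _ matrix_vector_mul_linear])
    have ind': "indep_var borel (\<lambda>\<omega>. V \<omega> \<bullet> b) borel (\<lambda>\<omega>. X \<omega> \<bullet> b)"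
      unfolding V_def
      by (rule indep_rv_indep_var[OF prob ind L2_measurable[OF W] L2_measurable[OF X],
            of "\<lambda>w. (T *v (w - m)) \<bullet> b" "\<lambda>x. x \<bullet> b"]) measurable
    show ?thesis
      using indep_var_lebesgue_integral[OF ind'] indep_var_integrable[OF ind'] intV intX mean
      by simp
  qed
  then have "(\<integral>\<omega>. (\<Sum>b\<in>Basis. V \<omega> \<bullet> b * (X \<omega> \<bullet> b)) \<partial>M) = 0"
    by simp
  moreover have "(\<Sum>b\<in>Basis. V \<omega> \<bullet> b * (X \<omega> \<bullet> b)) = X \<omega> \<bullet> V \<omega>" for \<omega>
    by (simp add: euclidean_inner[of "X \<omega>" "V \<omega>"] mult.commute)
  ultimately show ?thesis
    by (simp add: V_def m_def)
qed

section \<open>Positive definite forms and the Riccati equation\<close>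

lemma pos_def_matrix_inv_right:
  fixes G :: "real^'n^'n"
  assumes "pos_def G"
  shows "G ** matrix_inv G = mat 1"
proof -
  have "\<forall>x. G *v x = 0 \<longrightarrow> x = 0"
    using assms by (metis pos_def_def inner_zero_right less_irrefl)
  then have "invertible G"
    by (simp add: invertible_left_inverse matrix_left_invertible_ker)
  then show ?thesis
    unfolding invertible_def matrix_inv_def by (rule someI_ex[THEN conjunct1])
qed

text \<open>The quadratic form attains a positive minimum on the unit sphere, and homogeneity extends the
  bound.\<close>

lemma pos_def_coercive:
  fixes S :: "real^'n^'n"
  assumes "pos_def S"
  obtains s where "s > 0" "\<And>x. s * (norm x)\<^sup>2 \<le> x \<bullet> (S *v x)"
proof -
  have "continuous_on (sphere 0 1) (\<lambda>x::real^'n. x \<bullet> (S *v x))"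
    by (intro continuous_intros linear_continuous_on_compose[OF _ matrix_vector_mul_linear])
  moreover have "sphere (0::real^'n) 1 \<noteq> {}" "compact (sphere (0::real^'n) 1)"
    by auto
  ultimately obtain a :: "real^'n" where a: "norm a = 1"
    and min: "\<And>x. norm x = 1 \<Longrightarrow> a \<bullet> (S *v a) \<le> x \<bullet> (S *v x)"
    using continuous_attains_inf[of "sphere (0::real^'n) 1" "\<lambda>x. x \<bullet> (S *v x)"] by auto
  show ?thesis
  proof (rule that)
    have "a \<noteq> 0" using a by auto
    then show "a \<bullet> (S *v a) > 0"
      using assms by (simp add: pos_def_def)
    fix x :: "real^'n"
    show "(a \<bullet> (S *v a)) * (norm x)\<^sup>2 \<le> x \<bullet> (S *v x)"
    proof (cases "x = 0")
      case False
      then have "a \<bullet> (S *v a) \<le> (x /\<^sub>R norm x) \<bullet> (S *v (x /\<^sub>R norm x))"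
        by (intro min) simp
      also have "\<dots> = (x \<bullet> (S *v x)) / (norm x)\<^sup>2"
        by (simp add: matrix_vector_mult_scaleR power2_eq_square divide_simps)
      finally show ?thesis
        using False by (simp add: pos_le_divide_eq)
    qed simp
  qed
qed

text \<open>The gain is the minimizer in the Riccati equation. Stationarity in the control reads
  \<open>R K + B\<^sup>T P (A + B K) = 0\<close>, and substituting it into the equation gives \<open>P = Q + A\<^sup>T P (A + B K)\<close>.
  Tested with \<open>u\<close> and \<open>x\<close>, these two identities turn the mixed stage cost into a difference of the
  bilinear form of \<open>P\<close> before and after one closed-loop step of \<open>y\<close>, whatever control \<open>u\<close> acts on \<open>x\<close>.\<close>

lemma riccati_cross_term:
  fixes A :: "real^'n^'n" and B :: "real^'l^'n" and R :: "real^'l^'l"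
  assumes R: "pos_def R" and P: "psd P"
    and ric: "P = transpose A ** P ** A + Q
           - transpose A ** P ** B ** matrix_inv (R + transpose B ** P ** B) ** transpose B ** P ** A"
    and K: "K = - (matrix_inv (R + transpose B ** P ** B) ** transpose B ** P ** A)"
  shows "x \<bullet> (Q *v y) + u \<bullet> (R *v (K *v y)) =
    x \<bullet> (P *v y) - (A *v x + B *v u) \<bullet> (P *v (A *v y + B *v (K *v y)))"
proof -
  define G where "G = R + transpose B ** P ** B"
  have uminus: "(- T) *v a = - (T *v a)" "T *v (- a) = - (T *v a)" for T :: "real^'p^'q" and a
    using matrix_vector_mult_diff_rdistrib[of 0 T a] matrix_vector_mult_diff_distrib[of T 0 a]
    by simp_all
  have "pos_def G"
    unfolding pos_def_def
  proof (intro conjI allI impI)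
    have "transpose (R + T) = transpose R + transpose T" for T
      by (simp add: transpose_def vec_eq_iff)
    then show "transpose G = G"
      using R P by (simp add: G_def pos_def_def psd_def matrix_transpose_mul matrix_mul_assoc)
    fix w :: "real^'l" assume "w \<noteq> 0"
    then have "0 < w \<bullet> (R *v w)" "0 \<le> (B *v w) \<bullet> (P *v (B *v w))"
      using R P by (auto simp: pos_def_def psd_def)
    then show "0 < w \<bullet> (G *v w)"
      by (simp add: G_def matrix_inner_adjoint matrix_vector_mult_add_rdistrib inner_add_right
          matrix_vector_mul_assoc matrix_mul_assoc del: transpose_matrix_vector)
  qed
  then have inv: "G *v (matrix_inv G *v w) = w" for w
    by (simp add: matrix_vector_mul_assoc pos_def_matrix_inv_right)
  define b where "b = transpose B *v (P *v (A *v y))"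
  have Ky: "K *v y = - (matrix_inv G *v b)"
    by (simp add: K G_def b_def uminus matrix_vector_mul_assoc matrix_mul_assoc del: transpose_matrix_vector)
  have G: "G *v w = R *v w + transpose B *v (P *v (B *v w))" for w
    by (simp add: G_def matrix_vector_mult_add_rdistrib matrix_vector_mul_assoc matrix_mul_assoc
        del: transpose_matrix_vector)
  have "G *v (K *v y) = - b"
    by (simp add: Ky uminus inv)
  then have RK: "R *v (K *v y) = - b - transpose B *v (P *v (B *v (K *v y)))"
    unfolding G by (simp add: eq_diff_eq del: transpose_matrix_vector)
  have "P *v y = transpose A *v (P *v (A *v y)) + Q *v y - transpose A *v (P *v (B *v (matrix_inv G *v b)))"
    using arg_cong[OF ric, of "\<lambda>T. T *v y"]
    by (simp add: G_def b_def matrix_vector_mult_add_rdistrib matrix_vector_mult_diff_rdistrib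
        matrix_vector_mul_assoc matrix_mul_assoc del: transpose_matrix_vector)
  then have QY: "Q *v y = P *v y - transpose A *v (P *v (A *v y)) - transpose A *v (P *v (B *v (K *v y)))"
    by (simp add: Ky uminus del: transpose_matrix_vector)
  show ?thesis
    unfolding RK QY b_def
    by (simp add: matrix_inner_adjoint matrix_vector_right_distrib inner_add_left inner_add_right
        inner_diff_right del: transpose_matrix_vector)
qed

text \<open>Completing the square eliminates \<open>Y\<close>: the lower bound depends on the law of \<open>Z\<close> only. This is
  where positive definiteness of \<open>S\<close> pays for a mixed term of arbitrary size.\<close>

lemma storage_minus_cross_term_bounded_below:
  fixes S P :: "real^'n^'n" and Y Z :: "'w \<Rightarrow> real^'n"
  assumes prob: "prob_space M" and S: "pos_def S"
    and s: "s > 0" "\<And>x. s * (norm x)\<^sup>2 \<le> x \<bullet> (S *v x)"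
    and L2: "Y \<in> L2 M M" "Z \<in> L2 M M"
  shows "storage M S q Y - 2 * (\<integral>\<omega>. Y \<omega> \<bullet> (P *v Z \<omega>) \<partial>M)
    \<ge> - (\<integral>\<omega>. (norm (q - 2 *\<^sub>R (P *v Z \<omega>)))\<^sup>2 \<partial>M) / (4 * s)"
proof -
  interpret prob_space M by (rule prob)
  let ?p = "\<lambda>\<omega>. q - 2 *\<^sub>R (P *v Z \<omega>)"
  have norm_S: "(mat_norm S x)\<^sup>2 = x \<bullet> (S *v x)" for x
    using S by (cases "x = 0") (auto simp: mat_norm_def pos_def_def less_imp_le)
  have p: "?p \<in> L2 M M"
    by (intro L2_diff L2_const prob L2_bounded_linear[OF bounded_linear_scaleR_right] L2_matrix L2)
  have int: "integrable M (\<lambda>\<omega>. Y \<omega> \<bullet> (S *v Y \<omega>))" "integrable M (\<lambda>\<omega>. Y \<omega> \<bullet> (P *v Z \<omega>))"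
    "integrable M (\<lambda>\<omega>. Y \<omega> \<bullet> ?p \<omega>)" "integrable M (\<lambda>\<omega>. q \<bullet> Y \<omega>)"
    by (intro L2_inner_integrable L2 L2_matrix p L2_const prob)+
  have square: "- (norm p)\<^sup>2 / (4 * s) \<le> y \<bullet> (S *v y) + y \<bullet> p" for y p :: "real^'n"
  proof -
    have "0 \<le> (norm ((2 * s) *\<^sub>R y + p))\<^sup>2 / (4 * s)"
      using s(1) by simp
    also have "\<dots> = s * (norm y)\<^sup>2 + y \<bullet> p + (norm p)\<^sup>2 / (4 * s)"
      using s(1) unfolding power2_norm_eq_inner
      by (simp add: inner_add_left inner_add_right inner_commute field_simps)
    finally show ?thesis
      using s(2)[of y] by simp
  qed
  have "- (\<integral>\<omega>. (norm (?p \<omega>))\<^sup>2 \<partial>M) / (4 * s) = (\<integral>\<omega>. - (norm (?p \<omega>))\<^sup>2 / (4 * s) \<partial>M)"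
    by simp
  also have "\<dots> \<le> (\<integral>\<omega>. Y \<omega> \<bullet> (S *v Y \<omega>) + Y \<omega> \<bullet> ?p \<omega> \<partial>M)"
    using int L2_norm_integrable[OF p] square by (intro integral_mono) auto
  also have "\<dots> = (\<integral>\<omega>. (Y \<omega> \<bullet> (S *v Y \<omega>) + q \<bullet> Y \<omega>) - 2 * (Y \<omega> \<bullet> (P *v Z \<omega>)) \<partial>M)"
    by (intro Bochner_Integration.integral_cong) (auto simp: inner_diff_right inner_commute)
  also have "\<dots> = storage M S q Y - 2 * (\<integral>\<omega>. Y \<omega> \<bullet> (P *v Z \<omega>) \<partial>M)"
    using int by (simp add: storage_def norm_S)
  finally show ?thesis .
qed

section \<open>Counting exceptional times\<close>

lemma class_K_inf_mono:
  assumes "\<alpha> \<in> class_K_inf" "0 \<le> x" "x \<le> y"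
  shows "\<alpha> x \<le> \<alpha> y"
  using assms strict_mono_onD[of "{0..}" \<alpha> x y] by (cases "x = y") (auto simp: class_K_inf_def)

lemma class_K_inf_pos:
  assumes "\<alpha> \<in> class_K_inf" "0 < x"
  shows "0 < \<alpha> x"
  using assms strict_mono_onD[of "{0..}" \<alpha> 0 x] by (auto simp: class_K_inf_def)

text \<open>An exceptional time, at which the deviation reaches \<open>\<epsilon>\<close> with probability above \<open>\<eta>\<close>, has mean
  square deviation at least \<open>\<epsilon>\<^sup>2 * \<eta>\<close> by Chebyshev's inequality; a bounded sum leaves room for few of
  them.\<close>

lemma sum_K_inf_counts_small_deviations:
  fixes Y :: "nat \<Rightarrow> 'w \<Rightarrow> 'a::euclidean_space"
  assumes prob: "prob_space M" and Y: "\<And>k. Y k \<in> L2 M M"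
    and alpha: "\<alpha> \<in> class_K_inf"
    and total: "(\<Sum>k<N. \<alpha> (\<integral>\<omega>. (norm (Y k \<omega>))\<^sup>2 \<partial>M)) \<le> D"
    and pos: "\<epsilon> > 0" "\<eta> > 0"
  shows "real N - D / \<alpha> (\<epsilon>\<^sup>2 * \<eta>)
    \<le> real (card {k \<in> {0..<N}. measure M {\<omega> \<in> space M. norm (Y k \<omega>) \<ge> \<epsilon>} \<le> \<eta>})"
proof -
  interpret prob_space M by (rule prob)
  let ?a = "\<alpha> (\<epsilon>\<^sup>2 * \<eta>)" and ?m = "\<lambda>k. \<integral>\<omega>. (norm (Y k \<omega>))\<^sup>2 \<partial>M"
  let ?good = "{k \<in> {0..<N}. measure M {\<omega> \<in> space M. norm (Y k \<omega>) \<ge> \<epsilon>} \<le> \<eta>}"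
  define bad where "bad = {..<N} - ?good"
  have a: "?a > 0"
    by (rule class_K_inf_pos[OF alpha]) (use pos in simp)
  have large: "?a \<le> \<alpha> (?m k)" if "k \<in> bad" for k
  proof (rule class_K_inf_mono[OF alpha])
    have "\<eta> < measure M {\<omega> \<in> space M. norm (Y k \<omega>) \<ge> \<epsilon>}"
      using that by (auto simp: bad_def)
    also have "measure M {\<omega> \<in> space M. norm (Y k \<omega>) \<ge> \<epsilon>} = measure M {\<omega> \<in> space M. (norm (Y k \<omega>))\<^sup>2 \<ge> \<epsilon>\<^sup>2}"
      using pos by (simp add: abs_le_square_iff[symmetric])
    also have "\<dots> \<le> ?m k / \<epsilon>\<^sup>2"
      using pos L2_norm_integrable[OF Y]
      by (intro integral_Markov_inequality_measure[where A = "{}"]) auto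
    finally show "\<epsilon>\<^sup>2 * \<eta> \<le> ?m k"
      using pos by (simp add: pos_less_divide_eq mult.commute)
  qed (use pos in simp)
  have nonneg: "0 \<le> \<alpha> (?m k)" for k
    using class_K_inf_mono[OF alpha, of 0 "?m k"] alpha by (simp add: class_K_inf_def)
  have "real (card bad) * ?a \<le> (\<Sum>k\<in>bad. \<alpha> (?m k))"
    using sum_bounded_below[of bad ?a "\<lambda>k. \<alpha> (?m k)"] large by simp
  also have "\<dots> \<le> (\<Sum>k<N. \<alpha> (?m k))"
    by (rule sum_mono2) (auto simp: bad_def nonneg)
  finally have "real (card bad) * ?a \<le> D"
    using total by simp
  then have "real (card bad) \<le> D / ?a"
    using a by (simp add: pos_le_divide_eq)
  moreover have "card bad = N - card ?good"
    unfolding bad_def by (subst card_Diff_subset) auto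
  moreover have "card ?good \<le> N"
    by (rule order_trans[OF card_mono[of "{0..<N}"]]) auto
  ultimately show ?thesis
    by (simp add: of_nat_diff)
qed

section \<open>The turnpike property\<close>

theorem theorem4p4:
  fixes M :: "'w measure"
    and A :: "real^'n^'n" and B :: "real^'l^'n" and E :: "real^'m^'n" and z :: "real^'n"
    and W :: "nat \<Rightarrow> 'w \<Rightarrow> real^'m"
    and rho_W :: "(real^'m) measure" and mu_W :: "real^'m" and Sigma_W :: "real^'m^'m"
    and Q1 Q2 :: "real^'n^'n" and R1 R2 :: "real^'l^'l"
    and r :: "real^'n" and v :: "real^'l" and c :: real
    and xs :: "real^'n" and us :: "real^'l"
    and P :: "real^'n^'n" and K :: "real^'n^'l"
    and What :: "nat \<Rightarrow> 'w \<Rightarrow> real^'m"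
    and rhat :: "real^'n" and vhat :: "real^'l" and chat :: real
    and Xhat0 :: "'w \<Rightarrow> real^'n" and Xhat :: "nat \<Rightarrow> 'w \<Rightarrow> real^'n" and Uhat :: "nat \<Rightarrow> 'w \<Rightarrow> real^'l"
    and rho_hat :: "(real^'n) measure"
    and xt :: "real^'n" and ut :: "real^'l"
    and \<alpha> :: "real \<Rightarrow> real" and S :: "real^'n^'n" and q :: "real^'n"
    and Xstar :: "nat \<Rightarrow> 'w \<Rightarrow> real^'n" and Ustar :: "nat \<Rightarrow> 'w \<Rightarrow> real^'l"
  assumes prob: "prob_space M"
    and stab: "stabilizable A B"
    and W_L2: "\<And>k. W k \<in> L2 M M"
    and W_indep: "prob_space.indep_vars M (\<lambda>_. borel) W UNIV"
    and W_distr: "\<And>k. distr M borel (W k) = rho_W"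
    and W_mean: "\<And>k. (\<integral>\<omega>. W k \<omega> \<partial>M) = mu_W"
    and W_cov: "\<And>k. Cov M (W k) = Sigma_W"
    and cost: "psd Q1" "psd Q2" "psd R2" "pos_def R1"
    and steady: "(mat 1 - A) *v xs - B *v us = E *v mu_W + z"
    and detect: "detectable A (psd_sqrt Q1)"
    and P: "psd P"
      "P = transpose A ** P ** A + (Q1 + Q2)
           - transpose A ** P ** B ** matrix_inv ((R1 + R2) + transpose B ** P ** B)
             ** transpose B ** P ** A"
    and K: "K = - (matrix_inv ((R1 + R2) + transpose B ** P ** B) ** transpose B ** P ** A)"
    and What: "What = (\<lambda>k \<omega>. W k \<omega> - mu_W)"
    and rhat: "rhat = r + 2 *\<^sub>R (Q1 *v xs)"
    and vhat: "vhat = v + 2 *\<^sub>R (R1 *v us)"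
    and chat: "chat = xs \<bullet> (Q1 *v xs) + us \<bullet> (R1 *v us) + r \<bullet> xs + v \<bullet> us + c"
    and Xhat: "Xhat = feedback_solution A B E 0 What (\<lambda>x. K *v x) Xhat0"
    and Uhat: "Uhat = (\<lambda>k \<omega>. K *v Xhat k \<omega>)"
    and hat_adm: "admissible M W Xhat Uhat"
    and rho_hat: "rho_hat \<in> P2" "\<And>k. distr M borel (Xhat k) = rho_hat" "(\<integral>x. x \<partial>rho_hat) = 0"
    and tilde_steady: "(mat 1 - A) *v xt - B *v ut = 0"
    and alpha: "\<alpha> \<in> class_K_inf"
    and S: "pos_def S"
    and dissip: "\<And>X0 U X Xtil Util k.
        \<lbrakk> X = solution A B E z W U X0; admissible M W X U;
          Xtil = (\<lambda>\<omega>. X k \<omega> - xs - Xhat k \<omega>);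
          Util = (\<lambda>\<omega>. U k \<omega> - us - Uhat k \<omega>) \<rbrakk> \<Longrightarrow>
        stage_cost M Q1 Q2 R1 R2 rhat vhat chat Xtil Util
          - stage_cost M Q1 Q2 R1 R2 rhat vhat chat (\<lambda>_. xt) (\<lambda>_. ut)
          + storage M S q Xtil - storage M S q (\<lambda>\<omega>. A *v Xtil \<omega> + B *v Util \<omega>)
        \<ge> \<alpha> (\<integral>\<omega>. (norm (Xtil \<omega> - xt))\<^sup>2 \<partial>M)"
    and Xstar: "Xstar = feedback_solution A B E z W (\<lambda>x. K *v (x - xt - xs) + ut + us)
                          (\<lambda>\<omega>. Xhat 0 \<omega> + xs + xt)"
    and Ustar: "Ustar = (\<lambda>k \<omega>. K *v (Xstar k \<omega> - xt - xs) + ut + us)"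
  shows "\<forall>X0 \<in> L2 M M. \<exists>C::real. \<forall>N\<ge>1. \<forall>\<delta>>0. \<forall>U.
      admissible M W (solution A B E z W U X0) U \<and>
      (\<Sum>k<N. stage_cost M Q1 Q2 R1 R2 r v c (solution A B E z W U X0 k) (U k))
        \<le> \<delta> + (\<Sum>k<N. stage_cost M Q1 Q2 R1 R2 r v c (Xstar k) (Ustar k))
      \<longrightarrow> (\<forall>\<epsilon>>0. \<forall>\<eta>>0.
            real (card {k \<in> {0..<N}.
              measure M {\<omega> \<in> space M. norm (solution A B E z W U X0 k \<omega> - Xstar k \<omega>) \<ge> \<epsilon>} \<le> \<eta>})
            \<ge> real N - (\<delta> + C) / \<alpha> (\<epsilon>\<^sup>2 * \<eta>))"
proof (rule ballI)
  fix X0 :: "'w \<Rightarrow> real^'n"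
  assume X0: "X0 \<in> L2 M M"
  interpret prob_space M by (rule prob)
  let ?cost = "stage_cost M Q1 Q2 R1 R2 r v c"
  let ?hcost = "stage_cost M Q1 Q2 R1 R2 rhat vhat chat"
  have sym: "transpose Q1 = Q1" "transpose Q2 = Q2" "transpose R1 = R1" "transpose R2 = R2"
    using cost by (auto simp: psd_def pos_def_def)
  have R: "pos_def (R1 + R2)"
    unfolding pos_def_def
  proof (intro conjI allI impI)
    show "transpose (R1 + R2) = R1 + R2"
      using sym(3,4) by (simp add: transpose_def vec_eq_iff)
    fix w :: "real^'l" assume "w \<noteq> 0"
    then show "0 < w \<bullet> ((R1 + R2) *v w)"
      using cost(3,4) unfolding psd_def pos_def_def matrix_vector_mult_add_rdistrib inner_add_right
      by (intro add_pos_nonneg) auto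
  qed
  obtain s where s: "s > 0" "\<And>x. s * (norm x)\<^sup>2 \<le> x \<bullet> (S *v x)"
    using pos_def_coercive[OF S] by blast

  have Xhat_L2: "Xhat k \<in> L2 M M" for k
    using hat_adm L2_full by (auto simp: admissible_def)
  have Xhat_mean: "(\<integral>\<omega>. Xhat k \<omega> \<partial>M) = 0" for k
    using integral_distr[OF L2_measurable[OF Xhat_L2], of "\<lambda>x. x" k] rho_hat(2,3) by simp
  have Xhat_Suc: "Xhat (Suc k) \<omega> = (A *v Xhat k \<omega> + B *v (K *v Xhat k \<omega>)) + E *v (W k \<omega> - mu_W)"
    for k \<omega>
    by (simp add: Xhat What sys_def)

  have steady': "A *v xs + B *v us + E *v mu_W + z = xs" "A *v xt + B *v ut = xt"
    using steady tilde_steady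
    by (simp_all add: matrix_vector_mult_diff_rdistrib algebra_simps)
  have Xstar_eq: "Xstar k \<omega> = Xhat k \<omega> + xt + xs" for k \<omega>
  proof (induction k)
    case (Suc k)
    have "Xstar (Suc k) \<omega> = A *v Xstar k \<omega> + B *v (K *v (Xstar k \<omega> - xt - xs) + ut + us) + E *v W k \<omega> + z"
      by (simp add: Xstar sys_def)
    also have "\<dots> = Xhat (Suc k) \<omega> + (A *v xt + B *v ut) + (A *v xs + B *v us + E *v mu_W + z)"
      unfolding Suc Xhat_Suc
      by (simp add: matrix_vector_right_distrib matrix_vector_mult_diff_distrib)
    finally show ?case
      by (simp add: steady')
  qed (simp add: Xstar)
  have Ustar_eq: "Ustar k \<omega> = (ut + K *v Xhat k \<omega>) + us" for k \<omega>
    by (simp add: Ustar Xstar_eq)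

  \<comment> \<open>The constant is \<open>lam0 + D\<close>: initial storage minus initial mixed term, plus the remainder of
    the completed square at the final time.\<close>
  define lam0 where "lam0 = storage M S q (\<lambda>\<omega>. X0 \<omega> - xs - Xhat 0 \<omega>)
    - 2 * (\<integral>\<omega>. (X0 \<omega> - xs - Xhat 0 \<omega>) \<bullet> (P *v Xhat 0 \<omega>) \<partial>M)"
  define D where "D = (\<integral>x. (norm (q - 2 *\<^sub>R (P *v x)))\<^sup>2 \<partial>rho_hat) / (4 * s)"

  have main: "real N - (\<delta> + (lam0 + D)) / \<alpha> (\<epsilon>\<^sup>2 * \<eta>)
      \<le> real (card {k \<in> {0..<N}.
          measure M {\<omega> \<in> space M. norm (solution A B E z W U X0 k \<omega> - Xstar k \<omega>) \<ge> \<epsilon>} \<le> \<eta>})"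
    if adm: "admissible M W (solution A B E z W U X0) U"
      and J: "(\<Sum>k<N. ?cost (solution A B E z W U X0 k) (U k)) \<le> \<delta> + (\<Sum>k<N. ?cost (Xstar k) (Ustar k))"
      and pos: "\<epsilon> > 0" "\<eta> > 0"
    for N \<delta> U \<epsilon> \<eta>
  proof -
    let ?X = "solution A B E z W U X0"
    define Xt where "Xt = (\<lambda>k \<omega>. ?X k \<omega> - xs - Xhat k \<omega>)"
    define Ut where "Ut = (\<lambda>k \<omega>. U k \<omega> - us - Uhat k \<omega>)"
    have L2: "?X k \<in> L2 M M" "U k \<in> L2 M M" "Uhat k \<in> L2 M M" for k
      using adm hat_adm unfolding admissible_def by (blast intro: L2_full)+
    have Xt: "Xt k \<in> L2 M M" and Ut: "Ut k \<in> L2 M M" for k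
      unfolding Xt_def Ut_def by (intro L2_diff L2 L2_const prob Xhat_L2)+
    \<comment> \<open>Subtracting the stationary process removes the noise from the dynamics.\<close>
    have Xt_Suc: "Xt (Suc k) = (\<lambda>\<omega>. A *v Xt k \<omega> + B *v Ut k \<omega>)" for k
    proof
      fix \<omega>
      have "Xt (Suc k) \<omega> = A *v Xt k \<omega> + B *v Ut k \<omega> + (A *v xs + B *v us + E *v mu_W + z) - xs"
        by (simp add: Xt_def Ut_def Xhat_Suc Uhat sys_def matrix_vector_right_distrib
            matrix_vector_mult_diff_distrib)
      then show "Xt (Suc k) \<omega> = A *v Xt k \<omega> + B *v Ut k \<omega>"
        by (simp add: steady')
    qed

    define cross where "cross k = 2 * (\<integral>\<omega>. Xt k \<omega> \<bullet> (P *v Xhat k \<omega>) \<partial>M)" for k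
    \<comment> \<open>Independence from the noise is known for \<open>X\<close>, \<open>U\<close>, \<open>Xhat\<close> and \<open>Uhat\<close> separately, not
      jointly; by linearity of the correlation this suffices.\<close>
    have noise: "(\<integral>\<omega>. Xt (Suc k) \<omega> \<bullet> (P *v (E *v (W k \<omega> - mu_W))) \<partial>M) = 0" for k
    proof -
      have unc: "(\<integral>\<omega>. Z \<omega> \<bullet> (T *v (W k \<omega> - mu_W)) \<partial>M) = 0"
        if "indep_rv M (W k) Z" "Z \<in> L2 M M" for Z :: "'w \<Rightarrow> real^'j" and T :: "real^'m^'j"
        using indep_rv_uncorrelated[OF prob that(1) W_L2 that(2), of T] W_mean by simp
      have const: "(\<integral>\<omega>. a \<bullet> (T *v (W k \<omega> - mu_W)) \<partial>M) = 0" for a :: "real^'j" and T :: "real^'m^'j"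
      proof -
        have int: "integrable M (\<lambda>\<omega>. W k \<omega> - mu_W)"
          by (intro L2_integrable[OF prob] L2_diff L2_const W_L2 prob)
        then have "(\<integral>\<omega>. a \<bullet> (T *v (W k \<omega> - mu_W)) \<partial>M) = a \<bullet> (T *v (\<integral>\<omega>. W k \<omega> - mu_W \<partial>M))"
          by (intro integral_bounded_linear bounded_linear_compose[OF bounded_linear_inner_right]
              matrix_vector_mul_bounded_linear)
        then show ?thesis
          using L2_integrable[OF prob W_L2] W_mean by (simp add: prob_space)
      qed
      define TA where "TA = transpose A ** P ** E"
      define TB where "TB = transpose B ** P ** E"
      have V: "(\<lambda>\<omega>. W k \<omega> - mu_W) \<in> L2 M M"
        by (intro L2_diff L2_const W_L2 prob)
      note int = L2_inner_integrable[OF _ L2_matrix[OF V]]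
      have expand: "Xt (Suc k) \<omega> \<bullet> (P *v (E *v w)) =
          ((?X k \<omega> \<bullet> (TA *v w) - xs \<bullet> (TA *v w)) - Xhat k \<omega> \<bullet> (TA *v w))
        + ((U k \<omega> \<bullet> (TB *v w) - us \<bullet> (TB *v w)) - Uhat k \<omega> \<bullet> (TB *v w))" for \<omega> w
        unfolding Xt_Suc
        by (simp add: inner_add_left matrix_inner_adjoint Xt_def Ut_def TA_def TB_def inner_diff_left
            matrix_vector_mul_assoc matrix_mul_assoc del: transpose_matrix_vector)
      show ?thesis
        unfolding expand
        using adm hat_adm
        by (simp add: int L2 Xhat_L2 L2_const[OF prob] unc const admissible_def)
    qed
    have telescope: "2 * (\<integral>\<omega>. Xt k \<omega> \<bullet> ((Q1 + Q2) *v Xhat k \<omega>)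
        + Ut k \<omega> \<bullet> ((R1 + R2) *v (K *v Xhat k \<omega>)) \<partial>M) = cross k - cross (Suc k)" for k
    proof -
      let ?Y = "\<lambda>\<omega>. P *v (A *v Xhat k \<omega> + B *v (K *v Xhat k \<omega>))"
      let ?V = "\<lambda>\<omega>. P *v (E *v (W k \<omega> - mu_W))"
      have Y: "?Y \<in> L2 M M" and V: "?V \<in> L2 M M"
        by (intro L2_matrix L2_add L2_diff Xhat_L2 W_L2 L2_const prob)+
      have PX: "(\<lambda>\<omega>. P *v Xhat k \<omega>) \<in> L2 M M"
        by (intro L2_matrix Xhat_L2)
      note int = L2_inner_integrable[OF Xt PX] L2_inner_integrable[OF Xt Y] L2_inner_integrable[OF Xt V]
      have "cross (Suc k) = 2 * (\<integral>\<omega>. Xt (Suc k) \<omega> \<bullet> ?Y \<omega> + Xt (Suc k) \<omega> \<bullet> ?V \<omega> \<partial>M)"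
        by (simp add: cross_def Xhat_Suc matrix_vector_right_distrib inner_add_right add.assoc)
      also have "\<dots> = 2 * (\<integral>\<omega>. Xt (Suc k) \<omega> \<bullet> ?Y \<omega> \<partial>M)"
        by (subst Bochner_Integration.integral_add[OF int(2,3)]) (simp add: noise)
      finally have next_cross: "cross (Suc k) = 2 * (\<integral>\<omega>. Xt (Suc k) \<omega> \<bullet> ?Y \<omega> \<partial>M)" .
      have "(\<integral>\<omega>. Xt k \<omega> \<bullet> ((Q1 + Q2) *v Xhat k \<omega>) + Ut k \<omega> \<bullet> ((R1 + R2) *v (K *v Xhat k \<omega>)) \<partial>M)
        = (\<integral>\<omega>. Xt k \<omega> \<bullet> (P *v Xhat k \<omega>) - Xt (Suc k) \<omega> \<bullet> ?Y \<omega> \<partial>M)"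
        unfolding Xt_Suc
        by (intro Bochner_Integration.integral_cong refl riccati_cross_term[OF R P K])
      also have "\<dots> = (\<integral>\<omega>. Xt k \<omega> \<bullet> (P *v Xhat k \<omega>) \<partial>M) - (\<integral>\<omega>. Xt (Suc k) \<omega> \<bullet> ?Y \<omega> \<partial>M)"
        by (rule Bochner_Integration.integral_diff[OF int(1,2)])
      finally show ?thesis
        unfolding next_cross by (simp add: cross_def[of k])
    qed

    have cost_X: "?cost (?X k) (U k) =
        ?hcost (Xt k) (Ut k) + (?hcost (Xhat k) (Uhat k) - chat) + (cross k - cross (Suc k))" for k
    proof -
      have "?cost (?X k) (U k) =
          ?cost (\<lambda>\<omega>. (Xt k \<omega> + Xhat k \<omega>) + xs) (\<lambda>\<omega>. (Ut k \<omega> + K *v Xhat k \<omega>) + us)"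
        by (simp add: Xt_def Ut_def Uhat)
      also have "\<dots> = ?hcost (\<lambda>\<omega>. Xt k \<omega> + Xhat k \<omega>) (\<lambda>\<omega>. Ut k \<omega> + K *v Xhat k \<omega>)"
        unfolding rhat vhat chat
        by (intro stage_cost_shift prob L2_add L2_matrix Xt Ut Xhat_L2 sym)
      also have "\<dots> = ?hcost (Xt k) (Ut k) + ?hcost (Xhat k) (Uhat k) - chat + (cross k - cross (Suc k))"
        unfolding telescope[symmetric] Uhat
        by (intro stage_cost_add_centred prob Xt Ut Xhat_L2 sym Xhat_mean)
      finally show ?thesis by simp
    qed
    have cost_star: "?cost (Xstar k) (Ustar k) =
        ?hcost (\<lambda>_. xt) (\<lambda>_. ut) + (?hcost (Xhat k) (Uhat k) - chat)" for k
    proof -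
      have UX: "Ustar k = (\<lambda>\<omega>. (ut + K *v Xhat k \<omega>) + us)" "Xstar k = (\<lambda>\<omega>. (xt + Xhat k \<omega>) + xs)"
        by (auto simp: Ustar_eq Xstar_eq)
      have zero: "(\<integral>\<omega>. xt \<bullet> ((Q1 + Q2) *v Xhat k \<omega>) + ut \<bullet> ((R1 + R2) *v (K *v Xhat k \<omega>)) \<partial>M) = 0"
      proof -
        have "bounded_linear (\<lambda>y. xt \<bullet> ((Q1 + Q2) *v y) + ut \<bullet> ((R1 + R2) *v (K *v y)))"
          by (intro bounded_linear_add bounded_linear_compose[OF bounded_linear_inner_right]
              bounded_linear_compose[OF matrix_vector_mul_bounded_linear]
              matrix_vector_mul_bounded_linear)
        from integral_bounded_linear[OF this L2_integrable[OF prob Xhat_L2]] show ?thesis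
          by (simp add: Xhat_mean)
      qed
      have "?cost (Xstar k) (Ustar k) = ?hcost (\<lambda>\<omega>. xt + Xhat k \<omega>) (\<lambda>\<omega>. ut + K *v Xhat k \<omega>)"
        unfolding rhat vhat chat UX
        by (intro stage_cost_shift prob L2_add L2_matrix L2_const Xhat_L2 sym)
      also have "\<dots> = ?hcost (\<lambda>_. xt) (\<lambda>_. ut) + ?hcost (Xhat k) (Uhat k) - chat + 2 * 0"
        unfolding zero[symmetric] Uhat
        by (intro stage_cost_add_centred prob L2_const Xhat_L2 sym Xhat_mean)
      finally show ?thesis by simp
    qed

    \<comment> \<open>Dissipation in terms of the original costs: the mixed term joins the storage.\<close>
    have rotated: "\<alpha> (\<integral>\<omega>. (norm (Xt k \<omega> - xt))\<^sup>2 \<partial>M) \<le>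
        (?cost (?X k) (U k) - ?cost (Xstar k) (Ustar k))
        + (storage M S q (Xt k) - cross k) - (storage M S q (Xt (Suc k)) - cross (Suc k))" for k
    proof -
      have "Xt k = (\<lambda>\<omega>. ?X k \<omega> - xs - Xhat k \<omega>)" "Ut k = (\<lambda>\<omega>. U k \<omega> - us - Uhat k \<omega>)"
        by (simp_all add: Xt_def Ut_def)
      from dissip[OF refl adm this] show ?thesis
        unfolding Xt_Suc[symmetric] cost_X cost_star by linarith
    qed
    have "(\<Sum>k<N. \<alpha> (\<integral>\<omega>. (norm (Xt k \<omega> - xt))\<^sup>2 \<partial>M)) \<le>
        (\<Sum>k<N. ?cost (?X k) (U k)) - (\<Sum>k<N. ?cost (Xstar k) (Ustar k))
        + (storage M S q (Xt 0) - cross 0) - (storage M S q (Xt N) - cross N)"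
    proof (induction N)
      case (Suc N)
      then show ?case
        using rotated[of N] by simp
    qed simp
    moreover have "storage M S q (Xt 0) - cross 0 = lam0"
      by (simp add: lam0_def cross_def Xt_def)
    moreover have "- D \<le> storage M S q (Xt N) - cross N"
    proof -
      have "(\<lambda>x. (norm (q - 2 *\<^sub>R (P *v x)))\<^sup>2) \<in> borel_measurable borel"
        by (intro borel_measurable_continuous_onI continuous_intros
            linear_continuous_on_compose[OF _ matrix_vector_mul_linear])
      then have "D = (\<integral>\<omega>. (norm (q - 2 *\<^sub>R (P *v Xhat N \<omega>)))\<^sup>2 \<partial>M) / (4 * s)"
        unfolding D_def rho_hat(2)[of N, symmetric]
        by (subst integral_distr[OF L2_measurable[OF Xhat_L2]]) auto
      then show ?thesis
        using storage_minus_cross_term_bounded_below[OF prob S s Xt[of N] Xhat_L2[of N], of q P]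
        by (simp add: cross_def)
    qed
    ultimately have "(\<Sum>k<N. \<alpha> (\<integral>\<omega>. (norm (Xt k \<omega> - xt))\<^sup>2 \<partial>M)) \<le> \<delta> + (lam0 + D)"
      using J by linarith
    from sum_K_inf_counts_small_deviations[OF prob L2_diff[OF Xt L2_const[OF prob]] alpha this pos]
    show ?thesis
      by (simp add: Xt_def Xstar_eq algebra_simps)
  qed
  then show "\<exists>C::real. \<forall>N\<ge>1. \<forall>\<delta>>0. \<forall>U.
      admissible M W (solution A B E z W U X0) U \<and>
      (\<Sum>k<N. ?cost (solution A B E z W U X0 k) (U k)) \<le> \<delta> + (\<Sum>k<N. ?cost (Xstar k) (Ustar k))
      \<longrightarrow> (\<forall>\<epsilon>>0. \<forall>\<eta>>0.
            real (card {k \<in> {0..<N}.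
              measure M {\<omega> \<in> space M. norm (solution A B E z W U X0 k \<omega> - Xstar k \<omega>) \<ge> \<epsilon>} \<le> \<eta>})
            \<ge> real N - (\<delta> + C) / \<alpha> (\<epsilon>\<^sup>2 * \<eta>))"
    by (intro exI[of _ "lam0 + D"]) blast
qed

end
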